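(* Let $R_n(x)=\sum_{k=0}^{n-1} c_n(k)x^k$ for $n\ge 1$. (i) For every odd $n\ge 1$, $R_{2n}(x)=(1-x^n)R_n(-x)$. (ii) For every odd $n\ge 1$ and every $k\ge 1$, $R_{2^kn}(x)=2^{k-1}\big(1-x^{2^{k-1}n}\big)R_n\big(-x^{2^{k-1}}\big)$.
   Context: For integers $n\ge 1$ and $k$, the Ramanujan sum is $c_n(k)=\sum_{1\le j\le n,\ \gcd(j,n)=1} e^{2\pi i jk/n}$. *)

theory Defs
  imports Complex_Main "HOL-Computational_Algebra.Polynomial"
begin

definition ramanujan_sum :: "nat \<Rightarrow> int \<Rightarrow> complex" where
  "ramanujan_sum n k =
     (\<Sum>j | 1 \<le> j \<and> j \<le> n \<and> gcd j n = 1.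
        exp (2 * complex_of_real pi * \<i> * of_nat j * of_int k / of_nat n))"

definition ramanujan_poly :: "nat \<Rightarrow> complex poly" where
  "ramanujan_poly n = (\<Sum>k<n. monom (ramanujan_sum n (int k)) k)"

end

theory Submission
  imports Defs
begin

text \<open>
  For odd \<open>n\<close>, doubling the modulus gives \<open>c\<^sub>2\<^sub>n(k) = (-1)\<^sup>k c\<^sub>n(k)\<close>, and \<open>c\<^sub>n\<close> is \<open>n\<close>-periodic, so the two
  halves of \<open>R\<^sub>2\<^sub>n(x)\<close> are \<open>R\<^sub>n(-x)\<close> and \<open>-x\<^sup>n R\<^sub>n(-x)\<close>. For even \<open>m\<close>, the units modulo \<open>2m\<close> are \<open>j\<close> and
  \<open>j + m\<close> for \<open>j\<close> a unit modulo \<open>m\<close>, so \<open>c\<^sub>2\<^sub>m(k)\<close> is \<open>2 c\<^sub>m(k/2)\<close> for even \<open>k\<close> and \<open>0\<close> for odd \<open>k\<close>; hence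
  \<open>R\<^sub>2\<^sub>m(x) = 2 R\<^sub>m(x\<^sup>2)\<close>, and induction on the power of two finishes the proof.
\<close>

lemma exp_nat_mult_pi_ii: "exp (of_nat k * (complex_of_real pi * \<i>)) = (-1) ^ k"
  by (simp add: exp_of_nat_mult mult.commute)

text \<open>Raising \<open>k\<close> by \<open>n\<close> adds \<open>2 * j\<close> multiples of
  \<pi>i to each exponent, a period of \<open>exp\<close>.\<close>

lemma ramanujan_sum_add_modulus:
  assumes "n \<ge> 1"
  shows "ramanujan_sum n (int (k + n)) = ramanujan_sum n (int k)"
proof -
  have "exp (2 * complex_of_real pi * \<i> * of_nat j * of_int (int (k + n)) / of_nat n)
      = exp (2 * complex_of_real pi * \<i> * of_nat j * of_int (int k) / of_nat n)" for j
  proof -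
    have "2 * complex_of_real pi * \<i> * of_nat j * of_int (int (k + n)) / of_nat n
        = 2 * complex_of_real pi * \<i> * of_nat j * of_int (int k) / of_nat n
          + of_nat (2 * j) * (complex_of_real pi * \<i>)"
      using assms by (simp add: field_simps)
    then show ?thesis
      by (simp only: exp_add exp_nat_mult_pi_ii) simp
  qed
  then show ?thesis
    unfolding ramanujan_sum_def by simp
qed

text \<open>For odd \<open>n\<close>, the map i -> 2i + n is a bijection from the units modulo
  \<open>n\<close> to those modulo \<open>2 * n\<close>. The added \<open>n\<close> contributes
  exp(\<pi>ik) to each summand, which is the sign.\<close>

lemma ramanujan_sum_double_odd:
  assumes "odd n"
  shows "ramanujan_sum (2 * n) (int k) = (-1) ^ k * ramanujan_sum n (int k)"
proof -
  let ?U = "\<lambda>n. {j. 1 \<le> j \<and> j \<le> n \<and> gcd j n = (1::nat)}"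
  let ?e = "\<lambda>n j. exp (2 * complex_of_real pi * \<i> * of_nat j * of_int (int k) / of_nat n)"
  \<comment> \<open>The residue of \<open>2 i + n\<close> modulo \<open>2 n\<close> in the range \<open>1..2 n\<close>.\<close>
  define f where "f i = (if 2 * i < n then 2 * i + n else 2 * i - n)" for i
  \<comment> \<open>The inverse of \<open>f\<close>: comparing j with n reveals the branch, since 2i
    + n > n for i \<ge> 1 and 2i - n \<le> n for i \<le> n.\<close>
  define g where "g j = (if n < j then (j - n) div 2 else (j + n) div 2)" for j
  have n0: "n > 0"
    using assms by (cases n) auto
  have f_cases: "f i = 2 * i + n \<or> f i + n = 2 * i" for i
    unfolding f_def by auto
  have f_mem: "f i \<in> ?U (2 * n)" if "i \<in> ?U n" for i
  proof -
    have "odd (f i)"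
      using f_cases[of i] assms by presburger
    moreover have "coprime (f i) n"
    proof -
      have "coprime (2 * i) n"
        using that assms
        by (simp only: mem_Collect_eq coprime_iff_gcd_eq_1[symmetric]) simp
      moreover have "gcd (2 * i + n) n = gcd (2 * i) n" "gcd (f i + n) n = gcd (f i) n"
        by simp_all
      ultimately show ?thesis
        using f_cases[of i] by (metis coprime_iff_gcd_eq_1)
    qed
    ultimately have "coprime (f i) (2 * n)"
      by simp
    moreover have "1 \<le> f i" "f i \<le> 2 * n"
      using that \<open>odd (f i)\<close> odd_pos[of "f i"] by (auto simp: f_def)
    ultimately show ?thesis
      by (simp add: coprime_iff_gcd_eq_1)
  qed
  have g_mem: "g j \<in> ?U n \<and> f (g j) = j" if "j \<in> ?U (2 * n)" for j
  proof -
    have cop: "coprime j (2 * n)"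
      using that by (simp add: coprime_iff_gcd_eq_1)
    then have "odd j" and "coprime j n"
      by auto
    have g_cases: "j = 2 * g j + n \<and> n < j \<or> j + n = 2 * g j \<and> j \<le> n"
      using \<open>odd j\<close> assms unfolding g_def by auto
    have "coprime (2 * g j) n"
    proof -
      have "gcd (2 * g j + n) n = gcd (2 * g j) n" "gcd (j + n) n = gcd j n"
        by simp_all
      then show ?thesis
        using g_cases \<open>coprime j n\<close> by (metis coprime_iff_gcd_eq_1)
    qed
    then have "gcd (g j) n = 1"
      unfolding coprime_iff_gcd_eq_1[symmetric] by simp
    moreover have "1 \<le> g j" "g j \<le> n"
      using that g_cases by auto
    \<comment> \<open>If n < j \<le> 2n, then only 2 * \<open>g j\<close> \<le> n is known; parity
      makes it strict, so \<open>f\<close> takes its first branch.\<close>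
    moreover have "2 * g j \<noteq> n"
      using assms by auto
    then have "f (g j) = j"
      using g_cases that \<open>g j \<le> n\<close> unfolding f_def by auto
    ultimately show ?thesis
      by simp
  qed
  have g_f: "g (f i) = i" if "i \<in> ?U n" for i
    using that unfolding f_def g_def by auto
  have "?e (2 * n) (f i) = (-1) ^ k * ?e n i" for i
    using f_cases[of i]
  proof
    assume "f i = 2 * i + n"
    then have "2 * complex_of_real pi * \<i> * of_nat (f i) * of_int (int k) / of_nat (2 * n)
        = of_nat k * (complex_of_real pi * \<i>)
          + 2 * complex_of_real pi * \<i> * of_nat i * of_int (int k) / of_nat n"
      using n0 by (simp add: field_simps)
    then show ?thesis
      by (simp only: exp_add exp_nat_mult_pi_ii)
  next
    assume "f i + n = 2 * i"
    then have "of_nat (f i) + of_nat n = (2 * of_nat i :: complex)"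
      by (metis of_nat_add of_nat_mult of_nat_numeral)
    then have i_eq: "of_nat i = ((of_nat (f i) + of_nat n) / 2 :: complex)"
      by simp
    have "2 * complex_of_real pi * \<i> * of_nat i * of_int (int k) / of_nat n
        = of_nat k * (complex_of_real pi * \<i>)
          + 2 * complex_of_real pi * \<i> * of_nat (f i) * of_int (int k) / of_nat (2 * n)"
      unfolding i_eq using n0 by (simp add: field_simps)
    then have "?e n i = (-1) ^ k * ?e (2 * n) (f i)"
      by (simp only: exp_add exp_nat_mult_pi_ii)
    \<comment> \<open>The sign squares to 1, so it can be moved to the other side.\<close>
    then show ?thesis
      by (simp add: power_mult_distrib[symmetric] flip: mult.assoc)
  qed
  then have "(\<Sum>i\<in>?U n. (-1) ^ k * ?e n i) = (\<Sum>j\<in>?U (2 * n). ?e (2 * n) j)"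
    using f_mem g_mem g_f by (intro sum.reindex_bij_witness[of _ g f]) simp_all
  then show ?thesis
    by (simp add: ramanujan_sum_def sum_distrib_left)
qed

text \<open>Shifting j by \<open>m\<close> multiplies its summand by exp(\<pi>ik), so the sum over
  units up to \<open>m\<close> acquires the factor 1 + (-1)^k, which is 2 or 0.\<close>

lemma ramanujan_sum_double_even:
  assumes "even m" and "m \<ge> 1"
  shows "ramanujan_sum (2 * m) (int k) = (if even k then 2 * ramanujan_sum m (int (k div 2)) else 0)"
proof -
  let ?U = "\<lambda>n. {j. 1 \<le> j \<and> j \<le> n \<and> gcd j n = (1::nat)}"
  let ?e = "\<lambda>j. exp (2 * complex_of_real pi * \<i> * of_nat j * of_int (int k) / of_nat (2 * m))"
  \<comment> \<open>As \<open>m\<close> is even, coprimality to \<open>m\<close> already forces j to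
    be odd.\<close>
  have unit_iff: "gcd j (2 * m) = 1 \<longleftrightarrow> gcd j m = 1" for j
  proof -
    have "coprime j 2" if "coprime j m"
      using that assms(1) by (rule coprime_divisors[OF dvd_refl, rotated])
    then show ?thesis
      unfolding coprime_iff_gcd_eq_1[symmetric] by auto
  qed
  have U_split: "?U (2 * m) = ?U m \<union> (\<lambda>j. j + m) ` ?U m"
    unfolding unit_iff
  proof (intro equalityI subsetI)
    fix j assume j: "j \<in> {j. 1 \<le> j \<and> j \<le> 2 * m \<and> gcd j m = 1}"
    show "j \<in> ?U m \<union> (\<lambda>j. j + m) ` ?U m"
    proof (cases "j \<le> m")
      case True
      with j show ?thesis
        by auto
    next
      case False
      then obtain i where i: "j = i + m" "1 \<le> i"
        by (intro that[of "j - m"]) auto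
      moreover have "gcd i m = 1"
        using j i by simp
      ultimately show ?thesis
        using j by auto
    qed
  next
    fix j assume "j \<in> ?U m \<union> (\<lambda>j. j + m) ` ?U m"
    then show "j \<in> {j. 1 \<le> j \<and> j \<le> 2 * m \<and> gcd j m = 1}"
      by auto
  qed
  have "?e (j + m) = (-1) ^ k * ?e j" for j
  proof -
    have "2 * complex_of_real pi * \<i> * of_nat (j + m) * of_int (int k) / of_nat (2 * m)
        = of_nat k * (complex_of_real pi * \<i>)
          + 2 * complex_of_real pi * \<i> * of_nat j * of_int (int k) / of_nat (2 * m)"
      using assms(2) by (simp add: field_simps)
    then show ?thesis
      by (simp only: exp_add exp_nat_mult_pi_ii)
  qed
  then have shifted: "sum ?e ((\<lambda>j. j + m) ` ?U m) = (-1) ^ k * sum ?e (?U m)"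
    by (subst sum.reindex) (simp_all add: sum_distrib_left o_def del: of_nat_add)
  have "sum ?e (?U (2 * m)) = sum ?e (?U m) + sum ?e ((\<lambda>j. j + m) ` ?U m)"
    unfolding U_split by (rule sum.union_disjoint) auto
  then have "ramanujan_sum (2 * m) (int k) = (1 + (-1) ^ k) * sum ?e (?U m)"
    unfolding ramanujan_sum_def shifted by (simp add: algebra_simps)
  moreover have "sum ?e (?U m) = ramanujan_sum m (int (k div 2))" if "even k"
    using that by (elim evenE) (simp add: ramanujan_sum_def mult_ac)
  ultimately show ?thesis
    by simp
qed

lemma poly_ramanujan_poly:
  "poly (ramanujan_poly n) x = (\<Sum>k<n. ramanujan_sum n (int k) * x ^ k)"
  by (simp add: ramanujan_poly_def poly_sum poly_monom)

lemma poly_ramanujan_poly_double_odd: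
  assumes "odd n"
  shows "poly (ramanujan_poly (2 * n)) x = (1 - x ^ n) * poly (ramanujan_poly n) (- x)"
proof -
  let ?t = "\<lambda>k. ramanujan_sum (2 * n) (int k) * x ^ k"
  have n1: "n \<ge> 1"
    using assms by (cases n) auto
  have low: "?t k = ramanujan_sum n (int k) * (- x) ^ k" for k
    by (simp add: ramanujan_sum_double_odd[OF assms] power_minus[of x])
  \<comment> \<open>The minus sign is (-1)^n with \<open>n\<close> odd.\<close>
  have high: "?t (k + n) = - (x ^ n) * (ramanujan_sum n (int k) * (- x) ^ k)" for k
    using assms unfolding low ramanujan_sum_add_modulus[OF n1]
    by (simp add: power_add)
  have "{..<2 * n} = {..<n} \<union> {n..<n + n}"
    by auto
  then have "sum ?t {..<2 * n} = sum ?t {..<n} + sum ?t {n..<n + n}"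
    by (simp only: sum.union_disjoint[OF finite_lessThan finite_atLeastLessThan] ivl_disj_int)
  also have "sum ?t {n..<n + n} = (\<Sum>k<n. ?t (k + n))"
    using sum.shift_bounds_nat_ivl[of ?t 0 n n] by (simp add: lessThan_atLeast0)
  also have "\<dots> = - (x ^ n) * poly (ramanujan_poly n) (- x)"
    unfolding high poly_ramanujan_poly by (rule sum_distrib_left[symmetric])
  also have "sum ?t {..<n} = poly (ramanujan_poly n) (- x)"
    unfolding low poly_ramanujan_poly ..
  finally show ?thesis
    unfolding poly_ramanujan_poly[of "2 * n"] by (simp add: algebra_simps)
qed

lemma poly_ramanujan_poly_double_even:
  assumes "even m" and "m \<ge> 1"
  shows "poly (ramanujan_poly (2 * m)) x = 2 * poly (ramanujan_poly m) (x\<^sup>2)"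
proof -
  let ?t = "\<lambda>k. ramanujan_sum (2 * m) (int k) * x ^ k"
  \<comment> \<open>Coefficients at odd exponents vanish, which leaves a polynomial in the square of
    x.\<close>
  have "sum ?t {..<2 * m} = sum ?t ((*) 2 ` {..<m})"
  proof (rule sum.mono_neutral_right)
    show "\<forall>k\<in>{..<2 * m} - (*) 2 ` {..<m}. ?t k = 0"
      using ramanujan_sum_double_even[OF assms] by (auto elim!: evenE)
  qed auto
  also have "\<dots> = (\<Sum>k<m. ?t (2 * k))"
    by (subst sum.reindex) (auto simp: inj_on_def)
  also have "\<dots> = (\<Sum>k<m. 2 * (ramanujan_sum m (int k) * (x\<^sup>2) ^ k))"
    unfolding ramanujan_sum_double_even[OF assms] by (simp add: power_mult mult.assoc)
  finally show ?thesis
    by (simp add: poly_ramanujan_poly sum_distrib_left)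
qed

text \<open>The base case doubles an odd modulus; every later doubling has an even modulus. It
  replaces x by its square, so the induction must leave x arbitrary.\<close>

lemma poly_ramanujan_poly_power2_mult_odd:
  assumes "odd n"
  shows "poly (ramanujan_poly (2 ^ Suc k * n)) x
       = 2 ^ k * ((1 - x ^ (2 ^ k * n)) * poly (ramanujan_poly n) (- (x ^ (2 ^ k))))"
proof (induction k arbitrary: x)
  case 0
  show ?case
    using poly_ramanujan_poly_double_odd[OF assms] by simp
next
  case (Suc k)
  have "poly (ramanujan_poly (2 * (2 ^ Suc k * n))) x
      = 2 * poly (ramanujan_poly (2 ^ Suc k * n)) (x\<^sup>2)"
    using assms by (intro poly_ramanujan_poly_double_even) (auto simp: Suc_le_eq odd_pos)
  then show ?case
    unfolding Suc.IH by (simp add: mult.assoc flip: power_mult)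
qed

theorem theorem6:
  shows "(\<forall>n::nat. n \<ge> 1 \<and> odd n \<longrightarrow>
           ramanujan_poly (2 * n)
             = (1 - monom 1 n) * pcompose (ramanujan_poly n) (- monom 1 1))
       \<and> (\<forall>(n::nat) (k::nat). n \<ge> 1 \<and> odd n \<and> k \<ge> 1 \<longrightarrow>
           ramanujan_poly (2 ^ k * n)
             = smult (2 ^ (k - 1))
                 ((1 - monom 1 (2 ^ (k - 1) * n))
                   * pcompose (ramanujan_poly n) (- monom 1 (2 ^ (k - 1)))))"
proof (intro conjI allI impI; elim conjE)
  fix n :: nat
  assume "odd n"
  \<comment> \<open>Complex polynomials are determined by their values, so the pointwise identities
    suffice.\<close>
  then show "ramanujan_poly (2 * n)
      = (1 - monom 1 n) * pcompose (ramanujan_poly n) (- monom 1 1)"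
    by (subst poly_eq_poly_eq_iff[symmetric], intro ext)
      (simp add: poly_ramanujan_poly_double_odd poly_pcompose poly_monom)
next
  fix n k :: nat
  assume "odd n" and "k \<ge> 1"
  then obtain l where k: "k = Suc l"
    by (cases k) auto
  show "ramanujan_poly (2 ^ k * n)
      = smult (2 ^ (k - 1))
          ((1 - monom 1 (2 ^ (k - 1) * n))
            * pcompose (ramanujan_poly n) (- monom 1 (2 ^ (k - 1))))"
    unfolding k poly_eq_poly_eq_iff[symmetric]
    by (intro ext, subst poly_ramanujan_poly_power2_mult_odd[OF \<open>odd n\<close>])
      (simp add: poly_pcompose poly_monom)
qed

end
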